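(* Let $\mathcal{A}$ be a finite set of actions with $|\mathcal{A}|\ge2$ and $D\ge1$. For each $a\in\mathcal{A}$ let $\mathbf{c}_a\in\{-1/\sqrt{D},+1/\sqrt{D}\}^D$. Fix an input $x$ with encoding $\boldsymbol{\phi}(x)\in\mathbb{R}^D$, $\|\boldsymbol{\phi}(x)\|_2=1$, and let $a^*(x)=\arg\max_{a\in\mathcal{A}}\mathbf{c}_a^\top\boldsymbol{\phi}(x)$. Suppose that each coordinate of each $\mathbf{c}_a$ flips sign independently with probability $p$, where $0\le p<1/2$, giving random corrupted memories $\tilde{\mathbf{c}}_a$, $a\in\mathcal{A}$. Assume the similarity margin $$\Delta(x)=\mathbf{c}_{a^*(x)}^\top\boldsymbol{\phi}(x)-\max_{b\ne a^*(x)}\mathbf{c}_b^\top\boldsymbol{\phi}(x)$$ satisfies $\Delta(x)>0$. Then $$\Pr\Bigl[\arg\max_{a\in\mathcal{A}}\tilde{\mathbf{c}}_a^\top\boldsymbol{\phi}(x)\ne a^*(x)\Bigr]\le 2\,|\mathcal{A}|\,\exp\Bigl(-\frac{D\,(1-2p)^2\,\Delta(x)^2}{8}\Bigr).$$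
   Context: The corrupted memories are $\tilde c_{a,j}=\sigma_{a,j}c_{a,j}$, where the $\sigma_{a,j}\in\{-1,+1\}$ ($a\in\mathcal{A}$, $1\le j\le D$) are mutually independent random variables with $\Pr[\sigma_{a,j}=-1]=p$; the vectors $\mathbf{c}_a$ and $\boldsymbol{\phi}(x)$ are deterministic. The argmax of the corrupted similarities is taken with an arbitrary fixed tie-breaking rule. *)

theory Defs
  imports "HOL-Probability.Probability"
begin

definition corrupted_memory ::
  "('a \<Rightarrow> 'd \<Rightarrow> 'w \<Rightarrow> real) \<Rightarrow> ('a \<Rightarrow> real ^ 'd::finite) \<Rightarrow> 'w \<Rightarrow> 'a \<Rightarrow> real ^ 'd" where
  "corrupted_memory \<sigma> c \<omega> a = (\<chi> j. \<sigma> a j \<omega> * c a $ j)"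

definition similarity_margin ::
  "'a set \<Rightarrow> ('a \<Rightarrow> real ^ 'd::finite) \<Rightarrow> real ^ 'd \<Rightarrow> 'a \<Rightarrow> real" where
  "similarity_margin A c v a = c a \<bullet> v - Max ((\<lambda>b. c b \<bullet> v) ` (A - {a}))"

(* An argmax over A with a fixed but arbitrary tie-breaking rule: a deterministic function of the
   scores that returns a maximiser over A. As scores are total functions on the type of actions,
   the second conjunct says that scores outside A are irrelevant. *)
definition argmax_rule :: "'a set \<Rightarrow> (('a \<Rightarrow> real) \<Rightarrow> 'a) \<Rightarrow> bool" where
  "argmax_rule A r \<longleftrightarrow>
     (\<forall>f. is_arg_max f (\<lambda>a. a \<in> A) (r f)) \<and>
     (\<forall>f g. (\<forall>a\<in>A. f a = g a) \<longrightarrow> r f = r g)"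

end

theory Submission
  imports Defs
begin

text \<open>
  The corrupted score of an action \<open>a\<close> is a sum of independent random signs with weights
  \<open>w\<^sub>j = c\<^sub>a\<^sub>j \<phi>\<^sub>j\<close>; its mean is \<open>(1 - 2p) (c\<^sub>a \<bullet> \<phi>)\<close>, and \<open>\<Sum>\<^sub>j w\<^sub>j\<^sup>2 = 1/D\<close>. By Hoeffding's
  inequality it deviates from its mean by \<open>\<epsilon> = (1 - 2p) \<Delta> / 2\<close> or more with probability at most
  \<open>2 exp (- D \<epsilon>\<^sup>2 / 2)\<close>. If no score deviates by that much, then the score of \<open>a\<^sup>*\<close> remains strictly
  the largest, and a union bound over the actions concludes.
\<close>

lemma (in prob_space) indep_sets_reindex:
  assumes "inj_on f I" "indep_sets F (f ` I)"
  shows "indep_sets (\<lambda>i. F (f i)) I"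
  unfolding indep_sets_def
proof (intro conjI ballI allI impI)
  show "F (f i) \<subseteq> events" if "i \<in> I" for i
    using assms(2) that by (auto simp: indep_sets_def)
next
  fix J E assume J: "J \<subseteq> I" "J \<noteq> {}" "finite J" and E: "E \<in> (\<Pi> j\<in>J. F (f j))"
  have inj: "inj_on f J" using assms(1) J(1) by (rule inj_on_subset)
  have "prob (\<Inter>k\<in>f ` J. E (the_inv_into J f k)) = (\<Prod>k\<in>f ` J. prob (E (the_inv_into J f k)))"
    using J E by (intro indep_setsD[OF assms(2)]) (auto simp: the_inv_into_f_f[OF inj])
  then show "prob (\<Inter>j\<in>J. E j) = (\<Prod>j\<in>J. prob (E j))"
    by (simp add: prod.reindex[OF inj] the_inv_into_f_f[OF inj])
qed

lemma (in prob_space) indep_vars_reindex: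
  assumes "inj_on f I" "indep_vars N X (f ` I)"
  shows "indep_vars (\<lambda>i. N (f i)) (\<lambda>i. X (f i)) I"
proof -
  have "indep_sets (\<lambda>k. {X k -` A \<inter> space M |A. A \<in> sets (N k)}) (f ` I)"
    using assms(2) by (simp add: indep_vars_def2)
  from indep_sets_reindex[OF assms(1) this] show ?thesis
    using assms(2) by (simp add: indep_vars_def2)
qed

text \<open>A sign is \<open>1\<close> minus twice the indicator of the event that it equals
  \<open>-1\<close>.\<close>

lemma (in prob_space) expectation_random_sign:
  fixes s :: "'a \<Rightarrow> real"
  assumes [measurable]: "random_variable borel s"
    and sign: "\<And>\<omega>. \<omega> \<in> space M \<Longrightarrow> s \<omega> \<in> {-1, 1}"
  shows "expectation s = 1 - 2 * \<P>(\<omega> in M. s \<omega> = -1)"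
proof -
  let ?E = "{\<omega> \<in> space M. s \<omega> = -1}"
  have E [measurable]: "?E \<in> events" by measurable
  have "expectation s = expectation (\<lambda>\<omega>. 1 - 2 * indicator ?E \<omega>)"
    using sign by (intro Bochner_Integration.integral_cong) (auto simp: indicator_def)
  also have "\<dots> = 1 - 2 * prob ?E"
    by (subst Bochner_Integration.integral_diff) (auto simp: prob_space emeasure_eq_measure)
  finally show ?thesis .
qed

text \<open>Hoeffding's inequality with each summand in an interval of length
  \<open>2 * \<bar>w i\<bar>\<close>: the squared lengths add up to four times the sum of squared
  weights, which turns its exponent into the one stated. Positivity of that sum keeps the
  denominator nonzero.\<close>

lemma (in prob_space) random_sign_sum_deviation:
  fixes s :: "'i \<Rightarrow> 'a \<Rightarrow> real" and w :: "'i \<Rightarrow> real"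
  assumes "finite I" and indep: "indep_vars (\<lambda>_. borel) s I"
    and sign: "\<And>i \<omega>. i \<in> I \<Longrightarrow> \<omega> \<in> space M \<Longrightarrow> s i \<omega> \<in> {-1, 1}"
    and p: "\<And>i. i \<in> I \<Longrightarrow> \<P>(\<omega> in M. s i \<omega> = -1) = p"
    and "\<epsilon> \<ge> 0" and pos: "(\<Sum>i\<in>I. (w i)\<^sup>2) > 0"
  shows "prob {\<omega> \<in> space M. \<bar>(\<Sum>i\<in>I. s i \<omega> * w i) - (1 - 2 * p) * (\<Sum>i\<in>I. w i)\<bar> \<ge> \<epsilon>}
           \<le> 2 * exp (- \<epsilon>\<^sup>2 / (2 * (\<Sum>i\<in>I. (w i)\<^sup>2)))"
proof -
  have rv: "random_variable borel (s i)" if "i \<in> I" for i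
    using indep that unfolding indep_vars_def by blast
  interpret Hoeffding_ineq M I "\<lambda>i \<omega>. s i \<omega> * w i" "\<lambda>i. - \<bar>w i\<bar>" "\<lambda>i. \<bar>w i\<bar>"
      "\<Sum>i\<in>I. expectation (\<lambda>\<omega>. s i \<omega> * w i)"
  proof unfold_locales
    show "indep_vars (\<lambda>_. borel) (\<lambda>i \<omega>. s i \<omega> * w i) I"
      by (rule indep_vars_compose2[OF indep]) auto
    show "AE \<omega> in M. s i \<omega> * w i \<in> {- \<bar>w i\<bar>..\<bar>w i\<bar>}" if "i \<in> I" for i
      using sign[OF that] by (intro AE_I2) fastforce
  qed (use \<open>finite I\<close> in auto)
  have mean: "(\<Sum>i\<in>I. expectation (\<lambda>\<omega>. s i \<omega> * w i)) = (1 - 2 * p) * (\<Sum>i\<in>I. w i)"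
    using expectation_random_sign[OF rv sign] p by (simp add: sum_distrib_left)
  have width: "(\<Sum>i\<in>I. (\<bar>w i\<bar> - - \<bar>w i\<bar>)\<^sup>2) = 4 * (\<Sum>i\<in>I. (w i)\<^sup>2)"
    by (simp add: sum_distrib_left power_mult_distrib)
  show ?thesis
    using Hoeffding_ineq_abs_ge[OF \<open>\<epsilon> \<ge> 0\<close>] pos unfolding mean width by simp
qed

lemma similarity_margin_le:
  assumes "finite A" "b \<in> A" "b \<noteq> a"
  shows "c b \<bullet> v \<le> c a \<bullet> v - similarity_margin A c v a"
  using assms by (simp add: similarity_margin_def)

text \<open>A strict maximiser is the only one, so tie-breaking has no choice left.\<close>

lemma argmax_rule_eqI:
  assumes "argmax_rule A r" "a \<in> A" "\<And>b. b \<in> A \<Longrightarrow> b \<noteq> a \<Longrightarrow> f b < f a"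
  shows "r f = a"
  using assms unfolding argmax_rule_def is_arg_max_def by blast

text \<open>Every squared coordinate of \<open>u\<close> is the same constant, which factors out and
  leaves the squared norm of \<open>v\<close>. This is how the dimension enters the
  exponent.\<close>

lemma sum_squares_bipolar_weights:
  fixes u v :: "real ^ 'd::finite"
  assumes "\<And>j. u $ j \<in> {- 1 / sqrt (real CARD('d)), 1 / sqrt (real CARD('d))}"
    and "norm v = 1"
  shows "(\<Sum>j\<in>UNIV. (u $ j * v $ j)\<^sup>2) = 1 / real CARD('d)"
proof -
  have "(u $ j)\<^sup>2 = 1 / real CARD('d)" for j
    using assms(1)[of j] by (auto simp: power_divide)
  moreover have "(\<Sum>j\<in>UNIV. (v $ j)\<^sup>2) = 1"
    using assms(2) by (simp add: norm_vec_def L2_set_def)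
  ultimately show ?thesis
    by (simp add: power_mult_distrib flip: sum_divide_distrib)
qed

theorem proposition3:
  fixes M :: "'w measure"
    and A :: "'a set"
    and c :: "'a \<Rightarrow> real ^ 'd::finite"
    and \<phi> :: "'x \<Rightarrow> real ^ 'd"
    and x :: 'x
    and \<sigma> :: "'a \<Rightarrow> 'd \<Rightarrow> 'w \<Rightarrow> real"
    and p :: real
    and argmax :: "('a \<Rightarrow> real) \<Rightarrow> 'a"
    and a_star :: 'a
  assumes "prob_space M"
    and "finite A" and "card A \<ge> 2"
    and "\<And>a j. a \<in> A \<Longrightarrow> c a $ j \<in> {- 1 / sqrt (real CARD('d)), 1 / sqrt (real CARD('d))}"
    and "norm (\<phi> x) = 1"
    and "is_arg_max (\<lambda>a. c a \<bullet> \<phi> x) (\<lambda>a. a \<in> A) a_star"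
    and "0 \<le> p" and "p < 1 / 2"
    and "\<And>a j \<omega>. a \<in> A \<Longrightarrow> \<omega> \<in> space M \<Longrightarrow> \<sigma> a j \<omega> \<in> {-1, 1}"
    and "\<And>a j. a \<in> A \<Longrightarrow> \<P>(\<omega> in M. \<sigma> a j \<omega> = -1) = p"
    and "prob_space.indep_vars M (\<lambda>_. borel) (\<lambda>(a, j). \<sigma> a j) (A \<times> UNIV)"
    and "argmax_rule A argmax"
    and "similarity_margin A c (\<phi> x) a_star > 0"
  shows "\<P>(\<omega> in M. argmax (\<lambda>a. corrupted_memory \<sigma> c \<omega> a \<bullet> \<phi> x) \<noteq> a_star)
           \<le> 2 * real (card A) *
              exp (- (real CARD('d) * (1 - 2 * p)^2 * (similarity_margin A c (\<phi> x) a_star)^2 / 8))"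
proof -
  interpret prob_space M by fact
  let ?D = "real CARD('d)" and ?\<Delta> = "similarity_margin A c (\<phi> x) a_star"
  let ?S = "\<lambda>\<omega> a. corrupted_memory \<sigma> c \<omega> a \<bullet> \<phi> x"
  \<comment> \<open>Half of the least gap between the mean score of \<open>a_star\<close> and that
    of a rival: one deviation may lower the former while another raises the latter.\<close>
  define \<epsilon> where "\<epsilon> = (1 - 2 * p) * ?\<Delta> / 2"
  have "\<epsilon> > 0" using assms(8,13) by (simp add: \<epsilon>_def)
  have a_star: "a_star \<in> A" using assms(6) by (simp add: is_arg_max_def)
  define B where "B = (\<lambda>a. {\<omega> \<in> space M. \<bar>?S \<omega> a - (1 - 2 * p) * (c a \<bullet> \<phi> x)\<bar> \<ge> \<epsilon>})"
  \<comment> \<open>Regrouped so that the sign is the only random factor and the weights are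
    deterministic.\<close>
  have S: "?S \<omega> a = (\<Sum>j\<in>UNIV. \<sigma> a j \<omega> * (c a $ j * \<phi> x $ j))" for \<omega> a
    by (simp add: corrupted_memory_def inner_vec_def mult.assoc)
  have indep: "indep_vars (\<lambda>_. borel) (\<sigma> a) UNIV" if "a \<in> A" for a
  proof -
    have "indep_vars (\<lambda>_. borel) (\<lambda>(a, j). \<sigma> a j) (Pair a ` UNIV)"
      using that by (intro indep_vars_subset[OF assms(11)]) auto
    from indep_vars_reindex[OF _ this] show ?thesis by (simp add: inj_on_def comp_def)
  qed
  have B_sets: "B a \<in> events" if "a \<in> A" for a
  proof -
    have [measurable]: "random_variable borel (\<sigma> a j)" for j
      using indep[OF that] unfolding indep_vars_def by blast
    show ?thesis unfolding B_def S by measurable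
  qed
  have B_prob: "prob (B a) \<le> 2 * exp (- (?D * (1 - 2 * p)^2 * ?\<Delta>^2 / 8))" if "a \<in> A" for a
  proof -
    have w: "(\<Sum>j\<in>UNIV. (c a $ j * \<phi> x $ j)\<^sup>2) = 1 / ?D"
      using assms(4)[OF that] assms(5) by (rule sum_squares_bipolar_weights)
    have "prob (B a) \<le> 2 * exp (- \<epsilon>\<^sup>2 / (2 * (1 / ?D)))"
      \<comment> \<open>Reading \<open>w\<close> backwards restores the sum of squared weights in
        the bound, so that the goal has the form of the deviation lemma.\<close>
      unfolding B_def S inner_vec_def[of "c a"] inner_real_def w[symmetric]
      by (rule random_sign_sum_deviation)
         (use indep assms(9,10) that \<open>\<epsilon> > 0\<close> w in auto)
    \<comment> \<open>The \<open>8\<close> is the \<open>2\<close> of the deviation bound times the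
      \<open>4\<close> from squaring the half in \<open>\<epsilon>\<close>.\<close>
    also have "- \<epsilon>\<^sup>2 / (2 * (1 / ?D)) = - (?D * (1 - 2 * p)^2 * ?\<Delta>^2 / 8)"
      by (simp add: \<epsilon>_def power_divide power_mult_distrib)
    finally show ?thesis .
  qed
  have "{\<omega> \<in> space M. argmax (?S \<omega>) \<noteq> a_star} \<subseteq> (\<Union>a\<in>A. B a)"
  proof (rule subsetI, rule ccontr)
    fix \<omega> assume \<omega>: "\<omega> \<in> {\<omega> \<in> space M. argmax (?S \<omega>) \<noteq> a_star}" "\<omega> \<notin> (\<Union>a\<in>A. B a)"
    have close: "\<bar>?S \<omega> a - (1 - 2 * p) * (c a \<bullet> \<phi> x)\<bar> < \<epsilon>" if "a \<in> A" for a
      using \<omega> that by (auto simp: B_def not_le)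
    have "argmax (?S \<omega>) = a_star"
    proof (rule argmax_rule_eqI[OF assms(12) a_star])
      fix b assume b: "b \<in> A" "b \<noteq> a_star"
      have "(1 - 2 * p) * (c b \<bullet> \<phi> x) \<le> (1 - 2 * p) * (c a_star \<bullet> \<phi> x - ?\<Delta>)"
        using assms(8) by (intro mult_left_mono similarity_margin_le assms(2) b) auto
      also have "\<dots> = (1 - 2 * p) * (c a_star \<bullet> \<phi> x) - 2 * \<epsilon>"
        by (simp add: \<epsilon>_def right_diff_distrib)
      \<comment> \<open>The means are at least \<open>2 * \<epsilon>\<close> apart and both
        deviations are strictly below \<open>\<epsilon>\<close>, hence the strict
        inequality.\<close>
      finally show "?S \<omega> b < ?S \<omega> a_star"
        using close[OF b(1)] close[OF a_star] by linarith
    qed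
    with \<omega> show False by simp
  qed
  \<comment> \<open>Monotonicity asks measurability only of the larger set, so the error event,
    which involves an arbitrary tie-breaking rule, is bounded without a measurability proof.\<close>
  then have "prob {\<omega> \<in> space M. argmax (?S \<omega>) \<noteq> a_star} \<le> prob (\<Union>a\<in>A. B a)"
    using B_sets assms(2) by (intro finite_measure_mono) auto
  also have "\<dots> \<le> (\<Sum>a\<in>A. prob (B a))"
    using B_sets assms(2) by (intro finite_measure_subadditive_finite) auto
  also have "\<dots> \<le> (\<Sum>a\<in>A. 2 * exp (- (?D * (1 - 2 * p)^2 * ?\<Delta>^2 / 8)))"
    by (intro sum_mono B_prob)
  finally show ?thesis by simp
qed

end
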